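(* For every integer $n\ge 3$, the cycle $C_n$ on $n$ vertices satisfies \[ \operatorname{st}_{\gamma_{st}}(C_n)=\begin{cases}1,& \text{if } n\equiv 1 \pmod 3,\\ 2,& \text{if } n\equiv 2 \pmod 3,\\ 3,& \text{if } n\equiv 0 \pmod 3.\end{cases} \]
   Context: All graphs are finite, simple and undirected. For a graph $G=(V,E)$, a set $D\subseteq V$ is a strong dominating set if every vertex $v\in V\setminus D$ is adjacent to some $u\in D$ with $\deg(v)\le\deg(u)$ (degrees taken in $G$). The strong domination number $\gamma_{st}(G)$ is the minimum size of a strong dominating set; the graph with no vertices has $\gamma_{st}=0$. For $S\subseteq V$, $G-S$ is the graph obtained by deleting the vertices of $S$. The stability of the strong domination number is $\operatorname{st}_{\gamma_{st}}(G)=\min\{|S| : S\subseteq V,\ \gamma_{st}(G-S)\ne\gamma_{st}(G)\}$ (the choice $S=V$ is allowed). *)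

theory Defs
  imports "Graph_Theory.Graph_Theory"
begin

text \<open>
  A finite simple undirected graph is a digraph satisfying the locale \<^locale>\<open>graph\<close>: finite,
  loopfree, without parallel arcs and symmetric, so that an edge \<open>{u, v}\<close> is represented by the
  two arcs \<open>(u, v)\<close> and \<open>(v, u)\<close>. The degree of a vertex is then its
  \<^const>\<open>out_degree\<close>. The null graph is admitted. The definitions below are meant for such
  graphs; for other digraphs they carry no intended meaning.
\<close>

definition strong_dominating_set :: "('a, 'b) pre_digraph \<Rightarrow> 'a set \<Rightarrow> bool" where
  "strong_dominating_set G D \<longleftrightarrow>
     D \<subseteq> verts G \<and>
     (\<forall>v \<in> verts G - D. \<exists>u \<in> D. v \<rightarrow>\<^bsub>G\<^esub> u \<and> out_degree G v \<le> out_degree G u)"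

definition strong_domination_number :: "('a, 'b) pre_digraph \<Rightarrow> nat" where
  "strong_domination_number G = Min {card D | D. strong_dominating_set G D}"

definition delete_verts :: "('a, 'b) pre_digraph \<Rightarrow> 'a set \<Rightarrow> ('a, 'b) pre_digraph" where
  "delete_verts G S = G \<restriction> (verts G - S)"

text \<open>
  The set of admissible sizes is nonempty as soon as \<open>G\<close> has a vertex, since \<open>S = verts G\<close> leaves
  the null graph; for the null graph itself the minimum is unspecified.
\<close>

definition strong_domination_stability :: "('a, 'b) pre_digraph \<Rightarrow> nat" where
  "strong_domination_stability G =
     Min {card S | S. S \<subseteq> verts G \<and>
       strong_domination_number (delete_verts G S) \<noteq> strong_domination_number G}"

text \<open>The cycle on the vertices \<open>0, \<dots>, n - 1\<close>; it is a simple graph only for \<open>n \<ge> 3\<close>.\<close>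

definition cycle_graph :: "nat \<Rightarrow> nat pair_pre_digraph" where
  "cycle_graph n =
     \<lparr> pverts = {0..<n},
       parcs = {(i, j). i < n \<and> j < n \<and> (j = Suc i mod n \<or> i = Suc j mod n)} \<rparr>"

lemma pair_graph_cycle_graph:
  assumes "n \<ge> 3"
  shows "pair_graph (cycle_graph n)"
proof -
  have fin: "finite {(i, j). i < n \<and> j < n \<and> (j = Suc i mod n \<or> i = Suc j mod n)}"
    by (rule finite_subset[of _ "{0..<n} \<times> {0..<n}"]) auto
  have irr: "i \<noteq> Suc i mod n" "Suc i mod n \<noteq> i" if "i < n" for i
    using that assms by (cases "Suc i = n"; auto)+
  show ?thesis
    by unfold_locales
      (use fin irr in \<open>auto simp: cycle_graph_def symmetric_def sym_def\<close>)
qed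

lemma out_degree_cycle_graph:
  assumes "n \<ge> 3" "i < n"
  shows "out_degree (with_proj (cycle_graph n)) i = 2"
proof -
  let ?p = "if i = 0 then n - 1 else i - 1"
  have pred: "i = Suc j mod n \<longleftrightarrow> j = ?p" if "j < n" for j
    using that assms by (cases "Suc j = n") auto
  have p: "?p < n" "?p \<noteq> Suc i mod n"
    using assms by (cases "Suc i = n"; auto)+
  have "out_arcs (with_proj (cycle_graph n)) i = {(i, Suc i mod n), (i, ?p)}"
  proof -
    have "out_arcs (with_proj (cycle_graph n)) i =
        Pair i ` {j. j < n \<and> (j = Suc i mod n \<or> i = Suc j mod n)}"
      using assms by (auto simp: out_arcs_def cycle_graph_def)
    also have "{j. j < n \<and> (j = Suc i mod n \<or> i = Suc j mod n)} = {Suc i mod n, ?p}"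
    proof (intro set_eqI iffI)
      fix j assume "j \<in> {j. j < n \<and> (j = Suc i mod n \<or> i = Suc j mod n)}"
      then show "j \<in> {Suc i mod n, ?p}" using pred by blast
    next
      fix j assume "j \<in> {Suc i mod n, ?p}"
      then consider "j = Suc i mod n" | "j = ?p" by blast
      then show "j \<in> {j. j < n \<and> (j = Suc i mod n \<or> i = Suc j mod n)}"
      proof cases
        case 1
        then show ?thesis using assms by simp
      next
        case 2
        then have "j < n" using p(1) by blast
        then show ?thesis using pred 2 by blast
      qed
    qed
    finally show ?thesis by simp
  qed
  then show ?thesis
    using p by (simp add: out_degree_def)
qed

lemma strong_domination_number_null:
  assumes "verts G = {}"
  shows "strong_domination_number G = 0"
proof -
  have "{card D | D. strong_dominating_set G D} = {0}"
    using assms by (auto simp: strong_dominating_set_def)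
  then show ?thesis
    by (simp add: strong_domination_number_def)
qed

end

theory Submission
  imports Defs
begin

text \<open>
  Write \<open>n = 3 m + r\<close> with \<open>r \<in> {1, 2, 3}\<close>. All graphs involved have maximum
  degree at most 2, so a dominating set has at least a third as many elements as there are
  vertices, and leaves of a dominating set can be pushed to their neighbours, so that
  strong domination and ordinary domination have the same number. For \<open>j < r\<close> the \<open>m + 1\<close> vertices
  congruent to \<open>j\<close> modulo 3 dominate the cycle. Fewer than \<open>r\<close> deleted vertices miss one of these
  disjoint sets, which then still dominates, so the number stays \<open>m + 1\<close>. Deleting all but the
  path \<open>1, \<dots>, 3 m\<close> costs \<open>r\<close> vertices and leaves the dominating set \<open>2, 5, \<dots>, 3 m - 1\<close> of size \<open>m\<close>.
\<close>

section \<open>Strong domination under degree bounds\<close>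

lemma (in nomulti_digraph) out_degree_conv_card_dominates:
  "out_degree G v = card {w. v \<rightarrow> w}"
proof -
  have "inj_on (head G) (out_arcs G v)"
    by (rule inj_onI) (auto intro: no_multi_arcs simp: arc_to_ends_def)
  moreover have "head G ` out_arcs G v = {w. v \<rightarrow> w}"
    by (auto simp: arcs_ends_conv)
  ultimately show ?thesis
    unfolding out_degree_def by (metis card_image)
qed

context fin_digraph
begin

lemma finite_dominates: "finite {w. v \<rightarrow> w}"
  by (rule finite_subset[OF _ finite_verts]) (auto dest: adj_in_verts)

lemma finite_strong_dominating_cards: "finite {card D | D. strong_dominating_set G D}"
  by (rule finite_subset[of _ "card ` Pow (verts G)"]) (auto simp: strong_dominating_set_def)

lemma strong_domination_number_le:
  assumes "strong_dominating_set G D"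
  shows "strong_domination_number G \<le> card D"
  unfolding strong_domination_number_def
  by (rule Min_le) (use assms finite_strong_dominating_cards in auto)

lemma strong_domination_number_attained:
  obtains D where "strong_dominating_set G D" "card D = strong_domination_number G"
proof -
  have "strong_dominating_set G (verts G)"
    by (simp add: strong_dominating_set_def)
  then have "{card D | D. strong_dominating_set G D} \<noteq> {}"
    by blast
  then have "strong_domination_number G \<in> {card D | D. strong_dominating_set G D}"
    unfolding strong_domination_number_def
    using finite_strong_dominating_cards by (rule Min_in[rotated])
  then show ?thesis
    using that by auto
qed

end

text \<open>The closed neighbourhoods of a dominating set cover all vertices, and each has at most
  \<open>Suc k\<close> elements. Symmetry turns \<open>v \<rightarrow> u\<close> into membership of
  \<open>v\<close> in the neighbourhood of \<open>u\<close>.\<close>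

lemma (in graph) card_verts_le_strong_domination_number:
  assumes "\<And>v. out_degree G v \<le> k"
  shows "card (verts G) \<le> Suc k * strong_domination_number G"
proof -
  obtain D where D: "strong_dominating_set G D" "card D = strong_domination_number G"
    by (rule strong_domination_number_attained)
  have "verts G \<subseteq> (\<Union>u\<in>D. insert u {w. u \<rightarrow> w})"
    using D(1) arcs_ends_symmetric[OF sym_arcs] unfolding strong_dominating_set_def by blast
  moreover have "finite D"
    using D(1) by (auto simp: strong_dominating_set_def intro: finite_subset)
  ultimately have "card (verts G) \<le> card (\<Union>u\<in>D. insert u {w. u \<rightarrow> w})"
    by (intro card_mono) (auto simp: finite_dominates)
  also have "\<dots> \<le> (\<Sum>u\<in>D. card (insert u {w. u \<rightarrow> w}))"
    using \<open>finite D\<close> by (rule card_UN_le)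
  also have "\<dots> \<le> (\<Sum>u\<in>D. Suc k)"
  proof (rule sum_mono)
    fix u
    have "card (insert u {w. u \<rightarrow> w}) \<le> Suc (card {w. u \<rightarrow> w})"
      by (rule card_insert_le_m1) auto
    then show "card (insert u {w. u \<rightarrow> w}) \<le> Suc k"
      using assms[of u] by (simp add: out_degree_conv_card_dominates)
  qed
  finally show ?thesis
    using D(2) by (simp add: mult.commute)
qed

text \<open>Move every \<open>d\<close> in \<open>D\<close> that has a neighbour of larger degree to
  such a neighbour. As degrees are at most 2, a moved \<open>d\<close> has degree 1, so its only
  neighbour is its new position and no other vertex loses its dominator. An unmoved \<open>d\<close>
  strongly dominates all its neighbours.\<close>

lemma (in graph) strong_domination_number_le_dominating:
  assumes deg: "\<And>v. out_degree G v \<le> 2"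
    and sub: "D \<subseteq> verts G"
    and dom: "\<And>v. v \<in> verts G - D \<Longrightarrow> \<exists>u\<in>D. v \<rightarrow> u"
  shows "strong_domination_number G \<le> card D"
proof -
  \<comment> \<open>Since \<open>P\<close> is strict, \<open>f d = d\<close> holds exactly when
    \<open>d\<close> has no neighbour of larger degree.\<close>
  define P where "P d w \<longleftrightarrow> d \<rightarrow> w \<and> out_degree G d < out_degree G w" for d w
  define f where "f d = (if \<exists>w. P d w then SOME w. P d w else d)" for d
  have f: "P d (f d)" if "f d \<noteq> d" for d
    using that someI_ex[of "P d"] by (auto simp: f_def split: if_splits)
  have stay: "\<not> P d w" if "f d = d" for d w
  proof
    assume "P d w"
    then have "P d (f d)" by (auto simp: f_def intro: someI)
    then show False using that by (simp add: P_def)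
  qed
  have "strong_dominating_set G (f ` D)"
    unfolding strong_dominating_set_def
  proof (intro conjI ballI)
    show "f ` D \<subseteq> verts G"
    proof
      fix x assume "x \<in> f ` D"
      then obtain d where "d \<in> D" "x = f d" by blast
      then show "x \<in> verts G"
        using sub f[of d] adj_in_verts(2)[of d "f d"] by (cases "f d = d") (auto simp: P_def)
    qed
  next
    fix v assume v: "v \<in> verts G - f ` D"
    show "\<exists>u\<in>f ` D. v \<rightarrow> u \<and> out_degree G v \<le> out_degree G u"
    proof (cases "v \<in> D")
      case True
      then have "f v \<noteq> v" using v by force
      then show ?thesis
        using f[of v] True by (auto simp: P_def)
    next
      case False
      then obtain d where d: "d \<in> D" "v \<rightarrow> d" using dom v by blast
      then have dv: "d \<rightarrow> v" using arcs_ends_symmetric[OF sym_arcs] by blast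
      have "f d = d"
      proof (rule ccontr)
        assume "f d \<noteq> d"
        then have fd: "d \<rightarrow> f d" "out_degree G d < out_degree G (f d)"
          using f by (auto simp: P_def)
        then have "card {w. d \<rightarrow> w} \<le> 1"
          using deg[of "f d"] by (simp add: out_degree_conv_card_dominates)
        then have "v = f d"
          using fd(1) dv finite_dominates by (auto simp: card_le_Suc0_iff_eq)
        then show False using v d(1) by blast
      qed
      then have "\<not> P d v"
        by (rule stay)
      moreover have "d \<in> f ` D"
        using d(1) \<open>f d = d\<close> by (metis imageI)
      ultimately show ?thesis
        using d(2) dv unfolding P_def by (meson not_less)
    qed
  qed
  moreover have "card (f ` D) \<le> card D"
    using sub by (intro card_image_le) (auto intro: finite_subset)
  ultimately show ?thesis
    using strong_domination_number_le by fastforce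
qed

section \<open>Deletion of vertices\<close>

lemma verts_delete_verts [simp]: "verts (delete_verts G S) = verts G - S"
  by (simp add: delete_verts_def)

lemma dominates_delete_verts:
  "u \<rightarrow>\<^bsub>delete_verts G S\<^esub> v \<longleftrightarrow> u \<rightarrow>\<^bsub>G\<^esub> v \<and> u \<in> verts G - S \<and> v \<in> verts G - S"
  by (auto simp: delete_verts_def arcs_ends_conv)

lemma (in wf_digraph) delete_verts_empty: "delete_verts G {} = G"
  by (rule pre_digraph.equality) (auto simp: delete_verts_def)

lemma (in graph) graph_delete_verts: "graph (delete_verts G S)"
proof -
  have ind: "induced_subgraph (delete_verts G S) G"
    unfolding delete_verts_def by (rule induced_induce) blast
  interpret H: digraph "delete_verts G S"
    using ind by (rule digraphI_induced)
  show ?thesis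
    using induced_graph_imp_symmetric[OF sym_arcs ind] by (rule H.graphI)
qed

lemma (in fin_digraph) out_degree_delete_verts_le:
  "out_degree (delete_verts G S) v \<le> out_degree G v"
  unfolding out_degree_def
  by (rule card_mono) (auto simp: delete_verts_def)

section \<open>Cycles with deleted vertices\<close>

context
  fixes n :: nat
  assumes n: "n \<ge> 3"
begin

interpretation C: pair_graph "cycle_graph n"
  using n by (rule pair_graph_cycle_graph)

text \<open>Covers every \<open>v\<close>, vertex or not, because the general bounds assume the
  degree bound for all \<open>v\<close>.\<close>

lemma out_degree_delete_verts_cycle_graph_le:
  "out_degree (delete_verts (with_proj (cycle_graph n)) S) v \<le> 2"
proof (cases "v < n")
  case True
  then show ?thesis
    using C.out_degree_delete_verts_le[of S v] out_degree_cycle_graph[OF n] by simp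
next
  case False
  then have "out_arcs (with_proj (cycle_graph n)) v = {}"
    by (auto simp: cycle_graph_def)
  then show ?thesis
    using C.out_degree_delete_verts_le[of S v] by (simp add: out_degree_def)
qed

lemma card_le_strong_domination_number_delete_verts:
  assumes "S \<subseteq> {0..<n}"
  shows "n - card S \<le> 3 * strong_domination_number (delete_verts (with_proj (cycle_graph n)) S)"
proof -
  interpret H: graph "delete_verts (with_proj (cycle_graph n)) S"
    by (rule C.graph_delete_verts)
  have "card ({0..<n} - S) = n - card S"
    using assms by (simp add: card_Diff_subset finite_subset)
  then show ?thesis
    using H.card_verts_le_strong_domination_number[OF out_degree_delete_verts_cycle_graph_le]
    by (simp add: cycle_graph_def)
qed

text \<open>Reduces upper bounds to arithmetic modulo \<open>n\<close>: by leaf pushing it suffices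
  that \<open>D\<close> dominates the remaining vertices in the ordinary sense.\<close>

lemma strong_domination_number_delete_verts_le:
  assumes "D \<subseteq> {0..<n} - S"
    and "\<And>v. v \<in> {0..<n} - S \<Longrightarrow> v \<notin> D \<Longrightarrow> \<exists>u\<in>D. u = Suc v mod n \<or> v = Suc u mod n"
  shows "strong_domination_number (delete_verts (with_proj (cycle_graph n)) S) \<le> card D"
proof -
  interpret H: graph "delete_verts (with_proj (cycle_graph n)) S"
    by (rule C.graph_delete_verts)
  show ?thesis
  proof (rule H.strong_domination_number_le_dominating[OF out_degree_delete_verts_cycle_graph_le])
    show "D \<subseteq> verts (delete_verts (with_proj (cycle_graph n)) S)"
      using assms(1) by (simp add: cycle_graph_def)
    fix v assume "v \<in> verts (delete_verts (with_proj (cycle_graph n)) S) - D"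
    then have v: "v \<in> {0..<n} - S" "v \<notin> D"
      by (auto simp: cycle_graph_def)
    then obtain u where "u \<in> D" "u = Suc v mod n \<or> v = Suc u mod n"
      using assms(2) by blast
    then show "\<exists>u\<in>D. v \<rightarrow>\<^bsub>delete_verts (with_proj (cycle_graph n)) S\<^esub> u"
      using assms(1) v by (intro bexI[of _ u]) (auto simp: dominates_delete_verts cycle_graph_def)
  qed
qed

lemma strong_domination_number_delete_few:
  assumes nr: "n = 3 * m + r" "1 \<le> r" "r \<le> 3"
    and S: "S \<subseteq> {0..<n}" "card S < r"
  shows "strong_domination_number (delete_verts (with_proj (cycle_graph n)) S) = m + 1"
proof (rule antisym)
  have "finite S" using S(1) finite_subset by blast
  have "card ((\<lambda>v. v mod 3) ` S) < card {0..<r}"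
    using card_image_le[OF \<open>finite S\<close>, of "\<lambda>v. v mod 3"] S(2) by simp
  \<comment> \<open>Pigeonhole: \<open>S\<close> meets fewer than \<open>r\<close> residue classes
    modulo 3, so one with \<open>j < r\<close> is left intact. The bound \<open>j < r\<close> also
    gives \<open>3 * m + j < n\<close>, hence \<open>m + 1\<close> members.\<close>
  then obtain j where j: "j < r" "j \<notin> (\<lambda>v. v mod 3) ` S"
    using \<open>finite S\<close> card_mono[of "(\<lambda>v. v mod 3) ` S" "{0..<r}"] by fastforce
  define D where "D = (\<lambda>i. 3 * i + j) ` {..m}"
  have D_iff: "v \<in> D \<longleftrightarrow> v < n \<and> v mod 3 = j" for v
  proof
    assume "v \<in> D"
    then show "v < n \<and> v mod 3 = j" using j nr by (auto simp: D_def)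
  next
    assume "v < n \<and> v mod 3 = j"
    then have "v = 3 * (v div 3) + j" "v div 3 \<le> m"
      using nr by auto
    then show "v \<in> D" unfolding D_def by blast
  qed
  have "strong_domination_number (delete_verts (with_proj (cycle_graph n)) S) \<le> card D"
  proof (rule strong_domination_number_delete_verts_le)
    show "D \<subseteq> {0..<n} - S" using j D_iff by auto
    fix v assume v: "v \<in> {0..<n} - S" "v \<notin> D"
    then have "v < n" "v mod 3 \<noteq> j" by (auto simp: D_iff)
    have "j < 3" using j nr by simp
    moreover have "v mod 3 < 3" by simp
    \<comment> \<open>Among three consecutive numbers one is congruent to \<open>j\<close>, so the
      successor or the predecessor of \<open>v\<close> is. Only the ends \<open>n - 1\<close> and
      \<open>0\<close> need care, where the cycle wraps around.\<close>
    ultimately have "Suc v mod 3 = j \<or> v mod 3 = Suc j mod 3"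
      using \<open>v mod 3 \<noteq> j\<close> unfolding mod_Suc by (simp; arith)
    then consider (succ) "Suc v mod 3 = j" | (pred) "v mod 3 = Suc j mod 3"
      by blast
    then show "\<exists>u\<in>D. u = Suc v mod n \<or> v = Suc u mod n"
    proof cases
      case succ
      have "Suc v mod n \<in> D"
      proof (cases "Suc v = n")
        case True
        \<comment> \<open>With \<open>j < r\<close> this leaves only \<open>r = 3\<close> and
          \<open>j = 0\<close>, so the successor \<open>0\<close> of \<open>n - 1\<close> is in
          \<open>D\<close>.\<close>
        then have "r mod 3 = j" using succ nr by simp
        then have "j = 0" using j nr by (cases "r = 3") auto
        then show ?thesis using True n by (simp add: D_iff)
      next
        case False
        then show ?thesis using succ \<open>v < n\<close> by (simp add: D_iff)
      qed
      then show ?thesis by blast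
    next
      case pred
      show ?thesis
      proof (cases v)
        case 0
        \<comment> \<open>Now \<open>j < r\<close> forces \<open>r = 3\<close>, and the predecessor
          of \<open>0\<close> on the cycle is \<open>n - 1 = 3 * m + 2\<close>.\<close>
        then have "j = 2" using pred \<open>j < 3\<close> by (auto simp: mod_Suc split: if_splits)
        then have "r = 3" using j nr by simp
        then have "n - 1 \<in> D" using \<open>j = 2\<close> nr by (simp add: D_iff) presburger
        moreover have "v = Suc (n - 1) mod n" using 0 n by simp
        ultimately show ?thesis by blast
      next
        case (Suc u)
        then have "u mod 3 = j"
          using pred \<open>j < 3\<close> by (auto simp: mod_Suc split: if_splits)
        then have "u \<in> D" "v = Suc u mod n"
          using \<open>v < n\<close> Suc by (auto simp: D_iff)
        then show ?thesis by blast
      qed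
    qed
  qed
  also have "card D = m + 1"
    unfolding D_def by (subst card_image) (auto intro: inj_onI)
  finally show "strong_domination_number (delete_verts (with_proj (cycle_graph n)) S) \<le> m + 1" .
  \<comment> \<open>More than \<open>3 * m\<close> vertices remain, and each dominator accounts for
    at most three.\<close>
  show "m + 1 \<le> strong_domination_number (delete_verts (with_proj (cycle_graph n)) S)"
    using card_le_strong_domination_number_delete_verts[OF S(1)] S(2) nr by linarith
qed

text \<open>The path splits into triples \<open>3 * i + 1, 3 * i + 2, 3 * i + 3\<close>, each
  dominated by its middle vertex. As \<open>3 * m < n\<close>, no wraparound occurs. For
  \<open>m = 0\<close> everything is deleted and the null graph remains.\<close>

lemma strong_domination_number_path_le:
  assumes "3 * m < n"
  shows "strong_domination_number
    (delete_verts (with_proj (cycle_graph n)) ({0..<n} - {1..3 * m})) \<le> m"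
proof -
  define D where "D = (\<lambda>i. 3 * i + 2) ` {..<m}"
  have D_iff: "v \<in> D \<longleftrightarrow> v < 3 * m \<and> v mod 3 = 2" for v
  proof
    assume "v \<in> D"
    then obtain i where "i < m" "v = 3 * i + 2" by (auto simp: D_def)
    then show "v < 3 * m \<and> v mod 3 = 2" by presburger
  next
    assume "v < 3 * m \<and> v mod 3 = 2"
    then have "v = 3 * (v div 3) + 2" "v div 3 < m" by presburger+
    then show "v \<in> D" unfolding D_def by blast
  qed
  have "strong_domination_number
    (delete_verts (with_proj (cycle_graph n)) ({0..<n} - {1..3 * m})) \<le> card D"
  proof (rule strong_domination_number_delete_verts_le)
    show "D \<subseteq> {0..<n} - ({0..<n} - {1..3 * m})"
    proof
      fix v assume "v \<in> D"
      then have "v < 3 * m" "v \<noteq> 0" by (auto simp: D_iff intro: Nat.gr0I)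
      then show "v \<in> {0..<n} - ({0..<n} - {1..3 * m})" using assms by auto
    qed
    fix v assume "v \<in> {0..<n} - ({0..<n} - {1..3 * m})" "v \<notin> D"
    then have v: "1 \<le> v" "v \<le> 3 * m" "v mod 3 \<noteq> 2"
      by (auto simp: D_iff)
    then consider "v mod 3 = 0" | "v mod 3 = 1" by linarith
    then show "\<exists>u\<in>D. u = Suc v mod n \<or> v = Suc u mod n"
    proof cases
      case 1
      \<comment> \<open>Since \<open>v\<close> is positive, it is the last vertex of a triple, with
        middle \<open>v - 1 = 3 * i + 2\<close>.\<close>
      then obtain i where "v = 3 * Suc i"
        using v(1) by (metis mod_0_imp_dvd dvd_def mult_0_right not0_implies_Suc not_one_le_zero)
      then have "v - 1 \<in> D" using v(2) by (simp add: D_iff; presburger)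
      moreover have "v = Suc (v - 1) mod n" using v assms by simp
      ultimately show ?thesis by blast
    next
      case 2
      then have "Suc v \<in> D" using v unfolding D_iff by presburger
      moreover from this have "Suc v mod n = Suc v" using assms by (simp add: D_iff)
      ultimately show ?thesis by metis
    qed
  qed
  also have "card D = m"
    unfolding D_def by (subst card_image) (auto intro: inj_onI)
  finally show ?thesis .
qed

lemma strong_domination_stability_cycle_graph:
  assumes nr: "n = 3 * m + r" "1 \<le> r" "r \<le> 3"
  shows "strong_domination_stability (with_proj (cycle_graph n)) = r"
proof -
  let ?C = "with_proj (cycle_graph n)"
  have base: "strong_domination_number ?C = m + 1"
    using strong_domination_number_delete_few[OF nr, of "{}"] nr(2)
    unfolding C.delete_verts_empty by simp
  have V: "pverts (cycle_graph n) = {0..<n}"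
    by (simp add: cycle_graph_def)
  let ?A = "{card S | S. S \<subseteq> verts ?C \<and>
    strong_domination_number (delete_verts ?C S) \<noteq> strong_domination_number ?C}"
  have "Min ?A = r"
  proof (rule Min_eqI)
    show "finite ?A"
      by (rule finite_subset[of _ "card ` Pow {0..<n}"]) (auto simp: V)
    \<comment> \<open>Contrapositive: fewer than \<open>r\<close> deletions keep the value
      \<open>m + 1\<close>.\<close>
    fix x assume "x \<in> ?A"
    then show "r \<le> x"
      using strong_domination_number_delete_few[OF nr] by (auto simp: base V simp flip: not_less)
  next
    let ?S = "{0..<n} - {1..3 * m}"
    have "card ?S = r"
      using nr by (subst card_Diff_subset) auto
    moreover have "strong_domination_number (delete_verts ?C ?S) \<noteq> strong_domination_number ?C"
      using strong_domination_number_path_le[of m] nr base by simp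
    ultimately show "r \<in> ?A" by (auto simp: V)
  qed
  then show ?thesis
    by (simp add: strong_domination_stability_def)
qed

end

theorem proposition2p3:
  fixes n :: nat
  assumes "n \<ge> 3"
  shows "strong_domination_stability (with_proj (cycle_graph n)) =
    (if n mod 3 = 1 then 1 else if n mod 3 = 2 then 2 else 3)"
proof -
  let ?r = "if n mod 3 = 1 then 1 else if n mod 3 = 2 then 2 else 3 :: nat"
  \<comment> \<open>The shift to \<open>n - 1\<close> makes the remainder range over 1, 2, 3, with 3
    for multiples of 3.\<close>
  have "n = 3 * ((n - 1) div 3) + ?r"
    using assms by presburger
  then show ?thesis
    by (rule strong_domination_stability_cycle_graph[OF assms]) auto
qed

end
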